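(* Let $\Sigma_1,\ldots,\Sigma_\nu$ be signed graphs of orders $n_1,\ldots,n_\nu$, and let $\lambda_{i1}^L,\ldots,\lambda_{in_i}^L$ be the Laplacian eigenvalues of $\Sigma_i$. The Laplacian matrix of the Cartesian product $\Sigma=\Sigma_1\times\cdots\times\Sigma_\nu$ is $$L(\Sigma)=L(\Sigma_1)\otimes I_{n_2}\otimes\cdots\otimes I_{n_\nu}+\cdots+I_{n_1}\otimes I_{n_2}\otimes\cdots\otimes L(\Sigma_\nu)$$ (the sum over $i$ of the Kronecker products with $L(\Sigma_i)$ in the $i$th position and identity matrices in the other positions). The Laplacian eigenvalues of $\Sigma$ (with multiplicity) are the sums of those of the factors: $$\lambda^L_{j_1\cdots j_\nu}(\Sigma)=\sum_{i=1}^\nu\lambda_{ij_i}^L,\qquad 1\le j_i\le n_i.$$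
   Context: All graphs are finite, simple and loop-free. A signed graph $\Sigma=(G,\sigma)$ is a graph $G=(V,E)$ with a function $\sigma:E\to\{+1,-1\}$; its order is $|V|$. The adjacency matrix $A(\Sigma)$ has $(u,v)$ entry $\sigma(uv)$ if $u,v$ are adjacent and $0$ otherwise. $D(\Sigma)$ is the diagonal matrix of vertex degrees in the underlying graph $G$. The Laplacian matrix is $L(\Sigma)=D(\Sigma)-A(\Sigma)$; its eigenvalues are the Laplacian eigenvalues of $\Sigma$. The Cartesian product of signed graphs $\Sigma_i=(V_i,E_i,\sigma_i)$ is the signed graph on $V_1\times\cdots\times V_\nu$ in which $(u_1,\ldots,u_\nu)$ and $(v_1,\ldots,v_\nu)$ are adjacent iff there is an index $i$ with $u_iv_i\in E_i$ and $u_j=v_j$ for all $j\ne i$, such an edge having sign $\sigma_i(u_iv_i)$. Rows and columns of the Kronecker product are indexed by $\nu$-tuples of vertices, the entry being the product of the corresponding entries of the factors. $I_n$ is the identity matrix of order $n$. *)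

theory Defs
  imports "HOL-Library.FuncSet" "Jordan_Normal_Form.Char_Poly"
begin

section \<open>Signed graphs\<close>

record 'a sgraph =
  verts :: "'a set"
  edges :: "'a set set"
  esign :: "'a set \<Rightarrow> int"

locale signed_graph =
  fixes S :: "'a sgraph"
  assumes finite_verts: "finite (verts S)"
    and edges_wf: "e \<in> edges S \<Longrightarrow> \<exists>u v. u \<in> verts S \<and> v \<in> verts S \<and> u \<noteq> v \<and> e = {u, v}"
    and esign_range: "e \<in> edges S \<Longrightarrow> esign S e \<in> {1, -1}"

definition vertex_degree :: "'a sgraph \<Rightarrow> 'a \<Rightarrow> nat" where
  "vertex_degree S v = card {e \<in> edges S. v \<in> e}"

text \<open>A matrix whose rows and columns are indexed by a finite set \<open>V\<close> is a function
  \<open>V \<Rightarrow> V \<Rightarrow> real\<close>; only the values at arguments from \<open>V\<close> are meaningful.\<close>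

definition adjacency :: "'a sgraph \<Rightarrow> 'a \<Rightarrow> 'a \<Rightarrow> real" where
  "adjacency S u v = (if {u, v} \<in> edges S then of_int (esign S {u, v}) else 0)"

definition degree_mat :: "'a sgraph \<Rightarrow> 'a \<Rightarrow> 'a \<Rightarrow> real" where
  "degree_mat S u v = (if u = v then of_nat (vertex_degree S u) else 0)"

definition laplacian :: "'a sgraph \<Rightarrow> 'a \<Rightarrow> 'a \<Rightarrow> real" where
  "laplacian S u v = degree_mat S u v - adjacency S u v"

definition identity :: "'a \<Rightarrow> 'a \<Rightarrow> real" where
  "identity u v = (if u = v then 1 else 0)"

text \<open>Tuples over an index set \<open>I\<close> are extensional functions on \<open>I\<close>.\<close>

definition kronecker :: "'i set \<Rightarrow> ('i \<Rightarrow> 'a \<Rightarrow> 'a \<Rightarrow> real) \<Rightarrow> ('i \<Rightarrow> 'a) \<Rightarrow> ('i \<Rightarrow> 'a) \<Rightarrow> real" where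
  "kronecker I M u v = (\<Prod>i\<in>I. M i (u i) (v i))"


section \<open>Eigenvalues with multiplicity\<close>

definition mat_of_list :: "'v list \<Rightarrow> ('v \<Rightarrow> 'v \<Rightarrow> real) \<Rightarrow> real mat" where
  "mat_of_list vs M = mat (length vs) (length vs) (\<lambda>(i, j). M (vs ! i) (vs ! j))"

text \<open>The multiset of roots of the characteristic polynomial, that is, of eigenvalues with
  algebraic multiplicity. The enumeration of \<open>V\<close> chosen to form the characteristic polynomial
  is irrelevant, see \<open>eigenvalues_eq\<close> below.\<close>

definition eigenvalues :: "'v set \<Rightarrow> ('v \<Rightarrow> 'v \<Rightarrow> real) \<Rightarrow> real multiset" where
  "eigenvalues V M =
     proots (char_poly (mat_of_list (SOME vs. distinct vs \<and> set vs = V) M))"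

definition laplacian_eigenvalues :: "'a sgraph \<Rightarrow> real multiset" where
  "laplacian_eigenvalues S = eigenvalues (verts S) (laplacian S)"

lemma char_poly_mat_of_list_cong:
  assumes "distinct vs" "distinct ws" "set vs = set ws"
  shows "char_poly (mat_of_list vs M) = char_poly (mat_of_list ws M)"
proof -
  define n where "n = length vs"
  have n: "length vs = n" "length ws = n"
    using assms by (auto simp: n_def dest: distinct_card) (metis distinct_card)
  define X where "X = (\<lambda>xs ys. mat n n (\<lambda>(i, j). if xs ! i = (ys ! j :: 'a) then 1 else 0 :: real))"
  have X: "X xs ys \<in> carrier_mat n n" for xs ys by (simp add: X_def)
  have fin: "(\<Sum>k<n. if xs ! k = a then g (xs ! k) else (0::real)) = g a"
    if "distinct xs" "length xs = n" "a \<in> set xs" for xs a and g :: "'a \<Rightarrow> real"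
  proof -
    have "(\<Sum>k<n. if xs ! k = a then g (xs ! k) else 0) = (\<Sum>b\<in>set xs. if b = a then g b else 0)"
      by (rule sum.reindex_bij_betw)
        (use that bij_betw_nth[of xs "{..<n}" "set xs"] in auto)
    also have "\<dots> = g a" using that by simp
    finally show ?thesis .
  qed
  have L: "X as xs * mat n n (\<lambda>(i, j). h (xs ! i) (bs ! j)) = mat n n (\<lambda>(i, j). h (as ! i) (bs ! j))"
    if "distinct xs" "length xs = n" "set as = set xs" "length as = n"
    for as xs bs and h :: "'a \<Rightarrow> 'a \<Rightarrow> real"
    unfolding X_def
  proof (rule eq_matI, goal_cases)
    case (1 i j)
    have "(\<Sum>k<n. (if as ! i = xs ! k then 1 else 0) * h (xs ! k) (bs ! j)) =
      (\<Sum>k<n. if xs ! k = as ! i then h (xs ! k) (bs ! j) else 0)"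
      by (rule sum.cong) auto
    also have "\<dots> = h (as ! i) (bs ! j)"
      using fin[of xs "as ! i" "\<lambda>b. h b (bs ! j)"] that 1 nth_mem[of i as] by simp
    finally show ?case using 1 by (simp add: scalar_prod_def lessThan_atLeast0)
  qed auto
  have R: "mat n n (\<lambda>(i, j). h (as ! i) (xs ! j)) * X xs bs = mat n n (\<lambda>(i, j). h (as ! i) (bs ! j))"
    if "distinct xs" "length xs = n" "set bs = set xs" "length bs = n"
    for as xs bs and h :: "'a \<Rightarrow> 'a \<Rightarrow> real"
    unfolding X_def
  proof (rule eq_matI, goal_cases)
    case (1 i j)
    have "(\<Sum>k<n. h (as ! i) (xs ! k) * (if xs ! k = bs ! j then 1 else 0)) =
      (\<Sum>k<n. if xs ! k = bs ! j then h (as ! i) (xs ! k) else 0)"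
      by (rule sum.cong) auto
    also have "\<dots> = h (as ! i) (bs ! j)"
      using fin[of xs "bs ! j" "\<lambda>b. h (as ! i) b"] that 1 nth_mem[of j bs] by simp
    finally show ?case using 1 by (simp add: scalar_prod_def lessThan_atLeast0)
  qed auto
  have one: "X xs xs = 1\<^sub>m n" if "distinct xs" "length xs = n" for xs
    by (rule eq_matI) (use that in \<open>auto simp: X_def nth_eq_iff_index_eq\<close>)
  have inv: "X as xs * X xs as = 1\<^sub>m n"
    if "distinct xs" "length xs = n" "set as = set xs" "length as = n" "distinct as" for as xs
    using L[of xs as "\<lambda>a b. if a = b then 1 else 0" as] one[of as] that
    by (simp add: X_def)
  have "mat_of_list vs M = X vs ws * mat_of_list ws M * X ws vs"
    using assms n L[of ws vs M ws] R[of ws vs M vs] by (simp add: mat_of_list_def)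
  moreover have "mat_of_list vs M \<in> carrier_mat n n" "mat_of_list ws M \<in> carrier_mat n n"
    by (simp_all add: mat_of_list_def n)
  ultimately have "similar_mat_wit (mat_of_list vs M) (mat_of_list ws M) (X vs ws) (X ws vs)"
    using inv[of ws vs] inv[of vs ws] assms n X by (intro similar_mat_witI[of _ _ n]) simp_all
  then have "similar_mat (mat_of_list vs M) (mat_of_list ws M)"
    unfolding similar_mat_def by blast
  then show ?thesis by (rule char_poly_similar)
qed

lemma eigenvalues_eq:
  assumes "distinct vs" "set vs = V"
  shows "eigenvalues V M = proots (char_poly (mat_of_list vs M))"
proof -
  have "distinct (SOME vs. distinct vs \<and> set vs = V) \<and> set (SOME vs. distinct vs \<and> set vs = V) = V"
    using assms by (intro someI_ex[of "\<lambda>vs. distinct vs \<and> set vs = V"]) blast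
  then show ?thesis
    unfolding eigenvalues_def
    using assms by (intro arg_cong[of _ _ proots] char_poly_mat_of_list_cong) auto
qed


section \<open>Cartesian products\<close>

definition differ_by_edge ::
  "'i set \<Rightarrow> ('i \<Rightarrow> 'a sgraph) \<Rightarrow> 'i \<Rightarrow> ('i \<Rightarrow> 'a) \<Rightarrow> ('i \<Rightarrow> 'a) \<Rightarrow> bool" where
  "differ_by_edge I S i u v \<longleftrightarrow> {u i, v i} \<in> edges (S i) \<and> (\<forall>j\<in>I - {i}. u j = v j)"

text \<open>The index \<open>i\<close> in the sign is unique because \<open>u i \<noteq> v i\<close> for an edge; see
  \<open>esign_cartesian_product\<close> below.\<close>

definition cartesian_product :: "'i set \<Rightarrow> ('i \<Rightarrow> 'a sgraph) \<Rightarrow> ('i \<Rightarrow> 'a) sgraph" where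
  "cartesian_product I S = (let V = (\<Pi>\<^sub>E i\<in>I. verts (S i)) in
     \<lparr> verts = V,
       edges = {{u, v} | u v. u \<in> V \<and> v \<in> V \<and> (\<exists>i\<in>I. differ_by_edge I S i u v)},
       esign = (\<lambda>e. THE s. \<exists>u\<in>V. \<exists>v\<in>V. \<exists>i\<in>I.
          e = {u, v} \<and> differ_by_edge I S i u v \<and> s = esign (S i) {u i, v i}) \<rparr>)"

lemma differ_by_edge_sym: "differ_by_edge I S i u v \<longleftrightarrow> differ_by_edge I S i v u"
  unfolding differ_by_edge_def by (metis insert_commute)

lemma verts_cartesian_product:
  "verts (cartesian_product I S) = (\<Pi>\<^sub>E i\<in>I. verts (S i))"
  by (simp add: cartesian_product_def Let_def)

lemma edge_cartesian_product:
  assumes "u \<in> verts (cartesian_product I S)" "v \<in> verts (cartesian_product I S)"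
  shows "{u, v} \<in> edges (cartesian_product I S) \<longleftrightarrow> (\<exists>i\<in>I. differ_by_edge I S i u v)"
  using assms differ_by_edge_sym[of I S _ u v]
  by (auto simp: cartesian_product_def Let_def doubleton_eq_iff)

lemma esign_cartesian_product:
  assumes S: "\<And>i. i \<in> I \<Longrightarrow> signed_graph (S i)"
    and uv: "u \<in> verts (cartesian_product I S)" "v \<in> verts (cartesian_product I S)"
    and i: "i \<in> I" "differ_by_edge I S i u v"
  shows "esign (cartesian_product I S) {u, v} = esign (S i) {u i, v i}"
proof -
  have ne: "x k \<noteq> y k" if "k \<in> I" "differ_by_edge I S k x y" for k x y
    using signed_graph.edges_wf[OF S[OF that(1)], of "{x k, y k}"] that(2)
    by (auto simp: differ_by_edge_def doubleton_eq_iff)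
  have uniq: "k = i" if "k \<in> I" "differ_by_edge I S k u v" for k
    using ne[OF that] ne[OF i] that i by (auto simp: differ_by_edge_def)
  have "esign (cartesian_product I S) {u, v} =
    (THE s. \<exists>x\<in>verts (cartesian_product I S). \<exists>y\<in>verts (cartesian_product I S). \<exists>k\<in>I.
       {u, v} = {x, y} \<and> differ_by_edge I S k x y \<and> s = esign (S k) {x k, y k})"
    by (simp add: cartesian_product_def Let_def)
  also have "\<dots> = esign (S i) {u i, v i}"
  proof (rule the_equality)
    show "\<exists>x\<in>verts (cartesian_product I S). \<exists>y\<in>verts (cartesian_product I S). \<exists>k\<in>I.
       {u, v} = {x, y} \<and> differ_by_edge I S k x y \<and> esign (S i) {u i, v i} = esign (S k) {x k, y k}"
      using uv i by blast
  next
    fix s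
    assume "\<exists>x\<in>verts (cartesian_product I S). \<exists>y\<in>verts (cartesian_product I S). \<exists>k\<in>I.
       {u, v} = {x, y} \<and> differ_by_edge I S k x y \<and> s = esign (S k) {x k, y k}"
    then obtain x y k where k: "k \<in> I" "{u, v} = {x, y}" "differ_by_edge I S k x y"
      "s = esign (S k) {x k, y k}" by blast
    have "differ_by_edge I S k u v \<and> {x k, y k} = {u k, v k}"
      using k(2,3) differ_by_edge_sym[of I S k x y] by (auto simp: doubleton_eq_iff)
    then show "s = esign (S i) {u i, v i}" using uniq k by auto
  qed
  finally show ?thesis .
qed

lemma signed_graph_cartesian_product:
  assumes "finite I" and S: "\<And>i. i \<in> I \<Longrightarrow> signed_graph (S i)"
  shows "signed_graph (cartesian_product I S)"
proof
  show "finite (verts (cartesian_product I S))"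
    using assms by (auto simp: verts_cartesian_product intro: finite_PiE signed_graph.finite_verts)
next
  fix e assume e: "e \<in> edges (cartesian_product I S)"
  then obtain u v i where uv: "e = {u, v}" "u \<in> verts (cartesian_product I S)"
    "v \<in> verts (cartesian_product I S)" "i \<in> I" "differ_by_edge I S i u v"
    by (auto simp: cartesian_product_def Let_def)
  then have uvi: "{u i, v i} \<in> edges (S i)" by (simp add: differ_by_edge_def)
  have "u i \<noteq> v i"
    using signed_graph.edges_wf[OF S[OF uv(4)] uvi] by (auto simp: doubleton_eq_iff)
  then have "u \<noteq> v" by auto
  then show "\<exists>u v. u \<in> verts (cartesian_product I S) \<and> v \<in> verts (cartesian_product I S) \<and>
      u \<noteq> v \<and> e = {u, v}"
    using uv by blast
  show "esign (cartesian_product I S) e \<in> {1, -1}"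
    using esign_cartesian_product[OF S uv(2-5)] signed_graph.esign_range[OF S[OF uv(4)] uvi] uv(1)
    by simp
qed

end

theory Submission
  imports Defs "Jordan_Normal_Form.Schur_Decomposition"
begin

text \<open>
  Since \<open>L(\<Sigma>\<^sub>i)\<close> has \<open>n\<^sub>i\<close> real eigenvalues, it is similar to an upper triangular matrix \<open>T\<^sub>i\<close>
  with these eigenvalues on the diagonal in the prescribed order. The Kronecker product of the
  transition matrices transforms the Kronecker sum of the \<open>L(\<Sigma>\<^sub>i)\<close> into that of the \<open>T\<^sub>i\<close>, whose entry
  at \<open>(w, x)\<close> vanishes unless \<open>w \<le> x\<close> coordinatewise. Ordering the index tuples by their coordinate
  sum makes it triangular, with the sums of eigenvalues on the diagonal.
\<close>

section \<open>The Laplacian of a Cartesian product\<close>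

lemma (in signed_graph) edge_ends:
  assumes "{u, v} \<in> edges S"
  shows "u \<noteq> v" "u \<in> verts S" "v \<in> verts S"
  using edges_wf[OF assms] by (auto simp: doubleton_eq_iff)

text \<open>An edge at \<open>u\<close> is determined by its other end. Neighbours, unlike edges,
  are easy to follow coordinate by coordinate in a product.\<close>

lemma (in signed_graph) vertex_degree_neighbours:
  "vertex_degree S u = card {v. {u, v} \<in> edges S}"
proof -
  have "bij_betw (\<lambda>v. {u, v}) {v. {u, v} \<in> edges S} {e \<in> edges S. u \<in> e}"
    unfolding bij_betw_def
  proof
    show "inj_on (\<lambda>v. {u, v}) {v. {u, v} \<in> edges S}"
      by (auto simp: inj_on_def doubleton_eq_iff)
    show "(\<lambda>v. {u, v}) ` {v. {u, v} \<in> edges S} = {e \<in> edges S. u \<in> e}"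
    proof (intro subset_antisym subsetI)
      fix e assume "e \<in> {e \<in> edges S. u \<in> e}"
      moreover from this obtain x y where "e = {x, y}" using edges_wf by blast
      ultimately show "e \<in> (\<lambda>v. {u, v}) ` {v. {u, v} \<in> edges S}"
        by (auto simp: insert_commute)
    qed auto
  qed
  then show ?thesis
    unfolding vertex_degree_def by (simp add: bij_betw_same_card)
qed

lemma (in signed_graph) finite_neighbours: "finite {v. {u, v} \<in> edges S}"
  by (rule finite_subset[OF _ finite_verts]) (auto dest: edge_ends)

lemma (in signed_graph) laplacian_diag: "laplacian S u u = of_nat (vertex_degree S u)"
  using edge_ends[of u u] by (auto simp: laplacian_def degree_mat_def adjacency_def)

lemma laplacian_off_diag: "u \<noteq> v \<Longrightarrow> laplacian S u v = - adjacency S u v"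
  by (simp add: laplacian_def degree_mat_def)

text \<open>A neighbour of \<open>u\<close> arises by replacing a single coordinate
  \<open>u i\<close> with one of its neighbours in \<open>S i\<close>. Since graphs are loop-free,
  the changed index can be recovered, so the neighbourhood is a disjoint union over \<open>I\<close>
  of the neighbourhoods \<open>N i\<close>.\<close>

lemma vertex_degree_cartesian_product:
  assumes I: "finite I" and S: "\<And>i. i \<in> I \<Longrightarrow> signed_graph (S i)"
    and u: "u \<in> verts (cartesian_product I S)"
  shows "vertex_degree (cartesian_product I S) u = (\<Sum>i\<in>I. vertex_degree (S i) (u i))"
proof -
  let ?C = "cartesian_product I S"
  define N where "N = (\<lambda>i. {x. {u i, x} \<in> edges (S i)})"
  interpret C: signed_graph ?C using signed_graph_cartesian_product[OF I S] .
  have uV: "u \<in> (\<Pi>\<^sub>E i\<in>I. verts (S i))" using u by (simp add: verts_cartesian_product)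
  have N: "x \<noteq> u i" "x \<in> verts (S i)" if "i \<in> I" "x \<in> N i" for i x
    using signed_graph.edge_ends[OF S[OF that(1)], of "u i" x] that(2) by (auto simp: N_def)
  have upd: "u(i := x) \<in> verts ?C" if "i \<in> I" "x \<in> N i" for i x
    using N[OF that] uV that(1) by (auto simp: verts_cartesian_product PiE_iff extensional_def)
  have "bij_betw (\<lambda>(i, x). u(i := x)) (Sigma I N) {v. {u, v} \<in> edges ?C}"
    unfolding bij_betw_def
  proof
    show "inj_on (\<lambda>(i, x). u(i := x)) (Sigma I N)"
    proof (rule inj_onI, clarify)
      fix i x j y
      assume *: "i \<in> I" "x \<in> N i" "j \<in> I" "y \<in> N j" "u(i := x) = u(j := y)"
      \<comment> \<open>At coordinate \<open>i\<close> the left side is \<open>x\<close>, which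
        differs from \<open>u i\<close>; the right side must therefore be updated there too.\<close>
      have "i = j" using fun_cong[OF *(5), of i] N(1)[OF *(1,2)] by (auto split: if_splits)
      then show "i = j \<and> x = y" using fun_cong[OF *(5), of i] by simp
    qed
    show "(\<lambda>(i, x). u(i := x)) ` Sigma I N = {v. {u, v} \<in> edges ?C}"
    proof (intro subset_antisym subsetI)
      fix v assume "v \<in> (\<lambda>(i, x). u(i := x)) ` Sigma I N"
      then obtain i x where ix: "i \<in> I" "x \<in> N i" "v = u(i := x)" by auto
      then have "differ_by_edge I S i u v" by (auto simp: differ_by_edge_def N_def)
      then show "v \<in> {v. {u, v} \<in> edges ?C}"
        using edge_cartesian_product[OF u upd[OF ix(1,2)]] ix by auto
    next
      fix v assume "v \<in> {v. {u, v} \<in> edges ?C}"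
      then have v: "{u, v} \<in> edges ?C" by simp
      note vV = C.edge_ends(3)[OF v]
      obtain i where i: "i \<in> I" "differ_by_edge I S i u v"
        using edge_cartesian_product[OF u vV] v by auto
      \<comment> \<open>Outside \<open>I\<close> both tuples take the same default value by
        extensionality.\<close>
      have "v = u(i := v i)"
      proof
        fix j
        show "v j = (u(i := v i)) j"
          using i uV vV by (cases "j \<in> I")
            (auto simp: differ_by_edge_def verts_cartesian_product PiE_iff extensional_def)
      qed
      moreover have "v i \<in> N i" using i by (simp add: differ_by_edge_def N_def)
      ultimately show "v \<in> (\<lambda>(i, x). u(i := x)) ` Sigma I N"
        using i(1) by (intro image_eqI[of _ _ "(i, v i)"]) auto
    qed
  qed
  then have "vertex_degree ?C u = card (Sigma I N)"
    by (simp add: C.vertex_degree_neighbours bij_betw_same_card)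
  also have "\<dots> = (\<Sum>i\<in>I. card (N i))"
    using I signed_graph.finite_neighbours[OF S] by (intro card_SigmaI) (auto simp: N_def)
  also have "\<dots> = (\<Sum>i\<in>I. vertex_degree (S i) (u i))"
    by (intro sum.cong refl) (simp add: N_def signed_graph.vertex_degree_neighbours[OF S])
  finally show ?thesis .
qed

text \<open>The identity factors contribute 1 where the tuples agree and annihilate the product as
  soon as they differ away from \<open>i\<close>.\<close>

lemma kronecker_one_factor:
  assumes "finite I" "i \<in> I"
  shows "kronecker I (\<lambda>k. if k = i then M k else identity) u v =
    (if \<forall>k\<in>I - {i}. u k = v k then M i (u i) (v i) else 0)"
proof -
  have "kronecker I (\<lambda>k. if k = i then M k else identity) u v =
      M i (u i) (v i) * (\<Prod>k\<in>I - {i}. (if k = i then M k else identity) (u k) (v k))"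
    unfolding kronecker_def by (subst prod.remove[OF assms]) simp
  also have "(\<Prod>k\<in>I - {i}. (if k = i then M k else identity) (u k) (v k)) =
      (\<Prod>k\<in>I - {i}. if u k = v k then 1 else 0)"
    by (rule prod.cong) (auto simp: identity_def)
  also have "\<dots> = (if \<forall>k\<in>I - {i}. u k = v k then 1 else 0)"
    using assms(1) by (auto intro: prod_zero)
  finally show ?thesis by simp
qed

text \<open>On the diagonal every summand survives and the claim is additivity of degrees. Off the
  diagonal at most one summand is nonzero, namely that of the only coordinate in which
  \<open>u\<close> and \<open>v\<close> differ.\<close>

lemma laplacian_cartesian_product:
  assumes I: "finite I" and S: "\<And>i. i \<in> I \<Longrightarrow> signed_graph (S i)"
    and u: "u \<in> verts (cartesian_product I S)" and v: "v \<in> verts (cartesian_product I S)"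
  shows "laplacian (cartesian_product I S) u v =
    (\<Sum>i\<in>I. kronecker I (\<lambda>k. if k = i then laplacian (S k) else identity) u v)"
proof -
  let ?C = "cartesian_product I S"
  interpret C: signed_graph ?C using signed_graph_cartesian_product[OF I S] .
  have kron: "(\<Sum>i\<in>I. kronecker I (\<lambda>k. if k = i then laplacian (S k) else identity) u v) =
      (\<Sum>i\<in>I. if \<forall>k\<in>I - {i}. u k = v k then laplacian (S i) (u i) (v i) else 0)"
    using I by (intro sum.cong refl kronecker_one_factor)
  show ?thesis
  proof (cases "u = v")
    case True
    then show ?thesis unfolding kron
      using vertex_degree_cartesian_product[OF I S u]
      by (simp add: C.laplacian_diag signed_graph.laplacian_diag[OF S])
  next
    case False
    have ne: "u i \<noteq> v i" if "i \<in> I" "\<forall>k\<in>I - {i}. u k = v k" for i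
    proof
      assume "u i = v i"
      then have "u = v"
        using that u v by (intro PiE_ext[of u I "\<lambda>i. verts (S i)"])
          (auto simp: verts_cartesian_product)
      with False show False ..
    qed
    \<comment> \<open>A surviving entry is minus the sign of an edge of \<open>S i\<close>, which is
      the sign of the product edge; the value thus no longer depends on \<open>i\<close>.\<close>
    have "(\<Sum>i\<in>I. if \<forall>k\<in>I - {i}. u k = v k then laplacian (S i) (u i) (v i) else 0) =
        (\<Sum>i\<in>I. if differ_by_edge I S i u v then - of_int (esign ?C {u, v}) else 0)"
    proof (intro sum.cong refl)
      fix i assume i: "i \<in> I"
      show "(if \<forall>k\<in>I - {i}. u k = v k then laplacian (S i) (u i) (v i) else 0) =
          (if differ_by_edge I S i u v then - of_int (esign ?C {u, v}) else 0)"
        using ne[OF i] esign_cartesian_product[OF S u v i]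
        by (auto simp: laplacian_off_diag adjacency_def differ_by_edge_def)
    qed
    also have "\<dots> = - adjacency ?C u v"
    proof (cases "{u, v} \<in> edges ?C")
      case True
      then obtain i where i: "i \<in> I" "differ_by_edge I S i u v"
        using edge_cartesian_product[OF u v] by auto
      \<comment> \<open>For \<open>k\<close> other than \<open>i\<close>, the edge at
        \<open>i\<close> would force agreement at \<open>k\<close>, against
        \<open>ne\<close>.\<close>
      have "k = i" if "k \<in> I" "differ_by_edge I S k u v" for k
        using ne[of k] that i by (auto simp: differ_by_edge_def)
      then have "differ_by_edge I S k u v \<longleftrightarrow> k = i" if "k \<in> I" for k
        using i that by blast
      then have "(\<Sum>k\<in>I. if differ_by_edge I S k u v then - of_int (esign ?C {u, v}) else 0) =
          (\<Sum>k\<in>I. if k = i then - of_int (esign ?C {u, v}) else (0::real))"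
        by (intro sum.cong) auto
      then show ?thesis using True i(1) I by (simp add: adjacency_def)
    next
      case False
      then show ?thesis
        using edge_cartesian_product[OF u v] by (auto simp: adjacency_def intro: sum.neutral)
    qed
    finally show ?thesis unfolding kron using False by (simp add: laplacian_off_diag)
  qed
qed


section \<open>Triangularization\<close>

text \<open>Having as many roots as its degree means that \<open>p\<close> splits over the field:
  split off one root at a time by the factor theorem, by induction on the degree.\<close>

lemma monic_eq_prod_proots:
  fixes p :: "'a :: field poly"
  assumes "lead_coeff p = 1" "size (proots p) = degree p"
  shows "p = (\<Prod>a\<in>#proots p. [:-a, 1:])"
  using assms
proof (induction "degree p" arbitrary: p)
  case 0
  then have "p = 1" by (metis degree_0_id of_nat_1 one_pCons)
  then show ?case by simp
next
  case (Suc n)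
  then have "proots p \<noteq> {#}" by auto
  then obtain a where "a \<in># proots p" by blast
  moreover have p0: "p \<noteq> 0" using Suc.prems(1) by auto
  ultimately have "poly p a = 0" by (simp add: set_count_proots)
  then obtain q where q: "p = [:-a, 1:] * q" by (auto simp: poly_eq_0_iff_dvd dvd_def)
  have q0: "q \<noteq> 0" using p0 q by auto
  have lq: "lead_coeff q = 1" using Suc.prems(1) unfolding q lead_coeff_mult by simp
  have pr: "proots p = add_mset a (proots q)"
    using q0 unfolding q by (subst proots_mult) auto
  have "degree p = Suc (degree q)" using q0 unfolding q by (subst degree_mult_eq) auto
  then have "q = (\<Prod>a\<in>#proots q. [:-a, 1:])"
    using Suc.hyps Suc.prems lq pr by (intro Suc.hyps(1)) auto
  then show ?case using q pr by simp
qed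

section \<open>Passing between a matrix and its triangular form\<close>

lemma sum_list_index:
  assumes "distinct ws" "length ws = n"
  shows "(\<Sum>k = 0..<n. g (ws ! k)) = (\<Sum>w\<in>set ws. g w :: 'a :: comm_monoid_add)"
  by (rule sum.reindex_bij_betw)
    (use assms bij_betw_nth[of ws "{0..<n}" "set ws"] in \<open>auto simp: lessThan_atLeast0\<close>)

text \<open>Triangularity of \<open>T\<close> is expressed by a weight, so that no linear order on \<open>W\<close> is needed.\<close>

lemma eigenvalues_triangular:
  fixes M :: "'v \<Rightarrow> 'v \<Rightarrow> real" and P :: "'v \<Rightarrow> 'w \<Rightarrow> real" and f :: "'w \<Rightarrow> nat"
  assumes V: "finite V" and W: "finite W" and VW: "card V = card W"
    and PQ: "\<And>u v. u \<in> V \<Longrightarrow> v \<in> V \<Longrightarrow> (\<Sum>w\<in>W. P u w * Q w v) = identity u v"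
    and M: "\<And>u v. u \<in> V \<Longrightarrow> v \<in> V \<Longrightarrow> M u v = (\<Sum>w\<in>W. \<Sum>x\<in>W. P u w * T w x * Q x v)"
    and T: "\<And>w x. w \<in> W \<Longrightarrow> x \<in> W \<Longrightarrow> T w x \<noteq> 0 \<Longrightarrow> w = x \<or> f w < f x"
  shows "eigenvalues V M = {#T w w. w \<in># mset_set W#}"
proof -
  obtain vs where vs: "distinct vs" "set vs = V" using finite_distinct_list[OF V] by blast
  obtain ws0 where ws0: "distinct ws0" "set ws0 = W" using finite_distinct_list[OF W] by blast
  \<comment> \<open>Sorting by weight is what turns the weight condition on \<open>T\<close> into
    upper triangularity of a concrete matrix.\<close>
  define ws where "ws = sort_key f ws0"
  have ws: "distinct ws" "set ws = W" "sorted (map f ws)" using ws0 by (auto simp: ws_def)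
  define n where "n = card W"
  have n: "length ws = n" "length vs = n"
    using ws vs VW distinct_card[of ws] distinct_card[of vs] by (auto simp: n_def)
  define A where "A = mat_of_list vs M"
  define B where "B = mat_of_list ws T"
  define P' where "P' = mat n n (\<lambda>(i, j). P (vs ! i) (ws ! j))"
  define Q' where "Q' = mat n n (\<lambda>(i, j). Q (ws ! i) (vs ! j))"
  have carr: "A \<in> carrier_mat n n" "B \<in> carrier_mat n n" "P' \<in> carrier_mat n n" "Q' \<in> carrier_mat n n"
    by (simp_all add: A_def B_def P'_def Q'_def mat_of_list_def n)
  have mem: "vs ! i \<in> V" "ws ! i \<in> W" if "i < n" for i using that n vs ws nth_mem by metis+
  have one: "P' * Q' = 1\<^sub>m n"
  proof (rule eq_matI)
    fix i j assume "i < dim_row (1\<^sub>m n :: real mat)" "j < dim_col (1\<^sub>m n :: real mat)"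
    then have ij: "i < n" "j < n" by auto
    have "(P' * Q') $$ (i, j) = (\<Sum>k = 0..<n. P (vs ! i) (ws ! k) * Q (ws ! k) (vs ! j))"
      using ij by (simp add: P'_def Q'_def scalar_prod_def)
    also have "\<dots> = identity (vs ! i) (vs ! j)"
      using sum_list_index[OF ws(1) n(1), of "\<lambda>w. P (vs ! i) w * Q w (vs ! j)"] PQ mem ij ws(2)
      by simp
    finally show "(P' * Q') $$ (i, j) = 1\<^sub>m n $$ (i, j)"
      using ij vs(1) n(2) by (simp add: identity_def nth_eq_iff_index_eq)
  qed (use carr in auto)
  have "A = P' * B * Q'"
  proof (rule eq_matI)
    fix i j assume "i < dim_row (P' * B * Q')" "j < dim_col (P' * B * Q')"
    then have ij: "i < n" "j < n" using carr by auto
    have "(P' * B * Q') $$ (i, j) =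
        (\<Sum>l = 0..<n. (\<Sum>k = 0..<n. P (vs ! i) (ws ! k) * T (ws ! k) (ws ! l)) * Q (ws ! l) (vs ! j))"
      using ij by (simp add: P'_def Q'_def B_def mat_of_list_def n scalar_prod_def)
    also have "\<dots> = (\<Sum>l = 0..<n. \<Sum>k = 0..<n. P (vs ! i) (ws ! k) * T (ws ! k) (ws ! l) * Q (ws ! l) (vs ! j))"
      by (simp add: sum_distrib_right)
    also have "\<dots> = (\<Sum>x\<in>W. \<Sum>w\<in>W. P (vs ! i) w * T w x * Q x (vs ! j))"
      using sum_list_index[OF ws(1) n(1), of "\<lambda>w. P (vs ! i) w * T w x * Q x (vs ! j)" for x]
        sum_list_index[OF ws(1) n(1), of "\<lambda>x. \<Sum>w\<in>W. P (vs ! i) w * T w x * Q x (vs ! j)"]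
      by (simp add: ws(2))
    also have "\<dots> = M (vs ! i) (vs ! j)"
      using M mem ij by (subst sum.swap) simp
    finally show "A $$ (i, j) = (P' * B * Q') $$ (i, j)"
      using ij by (simp add: A_def mat_of_list_def n)
  qed (use carr in auto)
  \<comment> \<open>Only one of the two inverse identities is assumed; the other follows because
    \<open>card V = card W\<close> makes the matrices square.\<close>
  then have "similar_mat_wit A B P' Q'"
    using one mat_mult_left_right_inverse[OF carr(3,4) one] carr by (intro similar_mat_witI)
  then have "char_poly A = char_poly B"
    by (intro char_poly_similar) (auto simp: similar_mat_def)
  moreover have "upper_triangular B"
  proof (rule upper_triangularI)
    fix i j assume ij: "j < i" "i < dim_row B"
    then have "j < n" "i < n" using carr by auto
    \<comment> \<open>Below the diagonal the weight does not increase from row to column, and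
      distinctness of \<open>ws\<close> excludes the alternative \<open>w = x\<close>.\<close>
    then have "f (ws ! j) \<le> f (ws ! i)" "ws ! i \<noteq> ws ! j"
      using sorted_nth_mono[OF ws(3), of j i] ij n(1) ws(1) by (auto simp: nth_eq_iff_index_eq)
    then have "T (ws ! i) (ws ! j) = 0"
      using T[of "ws ! i" "ws ! j"] mem \<open>j < n\<close> \<open>i < n\<close> by force
    then show "B $$ (i, j) = 0"
      using \<open>j < n\<close> \<open>i < n\<close> by (simp add: B_def mat_of_list_def n)
  qed
  moreover have "diag_mat B = map (\<lambda>w. T w w) ws"
    by (rule nth_equalityI) (auto simp: diag_mat_def B_def mat_of_list_def)
  ultimately have "char_poly A = (\<Prod>w\<leftarrow>ws. [:- T w w, 1:])"
    using char_poly_upper_triangular[OF carr(2)] by (simp add: o_def)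
  moreover have "proots (\<Prod>w\<leftarrow>xs. [:- T w w, 1:]) = {#T w w. w \<in># mset xs#}" for xs
  proof (induction xs)
    case (Cons w xs)
    have "(\<Prod>w\<leftarrow>xs. [:- T w w, 1:]) \<noteq> 0" by (auto simp: prod_list_zero_iff)
    then show ?case using Cons by (simp add: proots_mult del: mult_pCons_left)
  qed simp
  moreover have "mset ws = mset_set W" using ws mset_set_set by metis
  ultimately show ?thesis
    using eigenvalues_eq[OF vs, of M] by (simp add: A_def)
qed

text \<open>The eigenvalue hypothesis supplies \<open>n\<close> real roots for a characteristic
  polynomial of degree \<open>n\<close>, so it splits over the reals and Schur decomposition
  applies. That decomposition respects the order of the given eigenvalue list, which puts
  \<open>e a\<close> at the diagonal position \<open>a\<close>.\<close>

lemma triangularization_exists: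
  fixes M :: "'v \<Rightarrow> 'v \<Rightarrow> real" and e :: "nat \<Rightarrow> real"
  assumes V: "finite V" "card V = n"
    and ev: "eigenvalues V M = {#e j. j \<in># mset_set {1..n}#}"
  shows "\<exists>P Q T.
    (\<forall>u\<in>V. \<forall>v\<in>V. (\<Sum>a\<in>{1..n}. P u a * Q a v) = identity u v) \<and>
    (\<forall>u\<in>V. \<forall>v\<in>V. M u v = (\<Sum>a\<in>{1..n}. \<Sum>b\<in>{1..n}. P u a * T a b * Q b v)) \<and>
    (\<forall>a\<in>{1..n}. \<forall>b\<in>{1..n}. T a b \<noteq> 0 \<longrightarrow> a \<le> b) \<and> (\<forall>a\<in>{1..n}. T a a = e a)"
proof -
  obtain vs where vs: "distinct vs" "set vs = V" using finite_distinct_list[OF V(1)] by blast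
  have len: "length vs = n" using vs V distinct_card[of vs] by auto
  define A where "A = mat_of_list vs M"
  define es where "es = map e [1..<Suc n]"
  have A: "A \<in> carrier_mat n n" by (simp add: A_def mat_of_list_def len)
  have pr: "proots (char_poly A) = mset es"
  proof -
    have "mset [1..<Suc n] = mset_set {1..n}"
      by (simp flip: atLeastLessThanSuc_atLeastAtMost del: upt_Suc)
    then show ?thesis
      using ev eigenvalues_eq[OF vs, of M] by (simp add: A_def es_def del: upt_Suc)
  qed
  have "char_poly A = (\<Prod>a\<in>#proots (char_poly A). [:-a, 1:])"
  proof (rule monic_eq_prod_proots)
    show "lead_coeff (char_poly A) = 1" "size (proots (char_poly A)) = degree (char_poly A)"
      using degree_monic_char_poly[OF A] by (auto simp: pr es_def)
  qed
  also have "\<dots> = (\<Prod>a\<leftarrow>es. [:-a, 1:])" by (simp add: pr flip: prod_mset_prod_list)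
  finally have cp: "char_poly A = (\<Prod>a\<leftarrow>es. [:-a, 1:])" .
  obtain B P' Q' where BPQ: "schur_decomposition A es = (B, P', Q')" by (metis prod_cases3)
  from schur_decomposition[OF A cp BPQ]
  have sim: "similar_mat_wit A B P' Q'" and tri: "upper_triangular B" and diag: "diag_mat B = es"
    by auto
  have "n = dim_row A" using A by simp
  note wit = similar_mat_witD[OF this sim]
  note one = wit(1) and eq = wit(3) and carr = wit(5-7)
  \<comment> \<open>The position of a vertex in \<open>vs\<close> translates matrices back into
    functions on \<open>V\<close>.\<close>
  define ix where "ix = (\<lambda>u. SOME i. i < n \<and> vs ! i = u)"
  have ix: "ix u < n" "vs ! ix u = u" if "u \<in> V" for u
  proof -
    have "\<exists>i. i < n \<and> vs ! i = u" using that vs len by (metis in_set_conv_nth)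
    from someI_ex[OF this] show "ix u < n" "vs ! ix u = u" by (auto simp: ix_def)
  qed
  \<comment> \<open>Eigenvalues are numbered from 1, matrix entries from 0; \<open>a - 1\<close> is
    never truncated because \<open>a\<close> is at least 1.\<close>
  have shift: "(\<Sum>a\<in>{1..n}. g (a - 1)) = (\<Sum>k = 0..<n. g k)" for g :: "nat \<Rightarrow> real"
    by (rule sum.reindex_bij_witness[of _ Suc "\<lambda>a. a - 1"]) auto
  show ?thesis
  proof (intro exI[of _ "\<lambda>u a. P' $$ (ix u, a - 1)"] exI[of _ "\<lambda>a u. Q' $$ (a - 1, ix u)"]
      exI[of _ "\<lambda>a b. B $$ (a - 1, b - 1)"] conjI ballI impI)
    fix u v assume uv: "u \<in> V" "v \<in> V"
    have "(\<Sum>a\<in>{1..n}. P' $$ (ix u, a - 1) * Q' $$ (a - 1, ix v)) = (P' * Q') $$ (ix u, ix v)"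
      using carr ix[OF uv(1)] ix[OF uv(2)] shift[of "\<lambda>k. P' $$ (ix u, k) * Q' $$ (k, ix v)"]
      by (simp add: scalar_prod_def)
    also have "\<dots> = identity u v"
    proof -
      have "ix u = ix v \<longleftrightarrow> u = v" using ix(2) uv by metis
      then show ?thesis using ix(1) uv by (simp add: one identity_def)
    qed
    finally show "(\<Sum>a\<in>{1..n}. P' $$ (ix u, a - 1) * Q' $$ (a - 1, ix v)) = identity u v" .
  next
    fix u v assume uv: "u \<in> V" "v \<in> V"
    have "M u v = A $$ (ix u, ix v)"
      using ix[OF uv(1)] ix[OF uv(2)] by (simp add: A_def mat_of_list_def len)
    also have "\<dots> = (\<Sum>k = 0..<n. \<Sum>l = 0..<n. P' $$ (ix u, k) * B $$ (k, l) * Q' $$ (l, ix v))"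
      using carr ix[OF uv(1)] ix[OF uv(2)]
      by (simp add: eq scalar_prod_def sum_distrib_left mult.assoc)
    also have "\<dots> = (\<Sum>a\<in>{1..n}. \<Sum>b\<in>{1..n}.
        P' $$ (ix u, a - 1) * B $$ (a - 1, b - 1) * Q' $$ (b - 1, ix v))"
      by (simp add: shift[of "\<lambda>l. P' $$ (ix u, k) * B $$ (k, l) * Q' $$ (l, ix v)" for k]
          shift[of "\<lambda>k. \<Sum>l = 0..<n. P' $$ (ix u, k) * B $$ (k, l) * Q' $$ (l, ix v)"] del: One_nat_def)
    finally show "M u v = (\<Sum>a\<in>{1..n}. \<Sum>b\<in>{1..n}.
        P' $$ (ix u, a - 1) * B $$ (a - 1, b - 1) * Q' $$ (b - 1, ix v))" .
  next
    fix a b assume ab: "a \<in> {1..n}" "b \<in> {1..n}" "B $$ (a - 1, b - 1) \<noteq> 0"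
    show "a \<le> b"
    proof (rule ccontr)
      assume "\<not> a \<le> b"
      then have "B $$ (a - 1, b - 1) = 0"
        using ab carr by (intro upper_triangularD[OF tri]) auto
      with ab show False by simp
    qed
  next
    fix a assume a: "a \<in> {1..n}"
    then have a1: "a - 1 < n" by auto
    then have "B $$ (a - 1, a - 1) = diag_mat B ! (a - 1)" using carr by (simp add: diag_mat_def)
    also have "\<dots> = e a" using a a1 by (simp add: diag es_def del: upt_Suc)
    finally show "B $$ (a - 1, a - 1) = e a" .
  qed
qed


section \<open>Eigenvalues of a Kronecker sum\<close>

text \<open>Distributivity, applied twice. It yields the mixed-product rule: a Kronecker product of
  triple matrix products is the triple product of the Kronecker products.\<close>

lemma prod_sum_sum_PiE:
  fixes g :: "'i \<Rightarrow> 'b \<Rightarrow> 'b \<Rightarrow> real"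
  assumes "finite I" "\<And>i. i \<in> I \<Longrightarrow> finite (W i)"
  shows "(\<Prod>i\<in>I. \<Sum>a\<in>W i. \<Sum>b\<in>W i. g i a b) =
    (\<Sum>w\<in>Pi\<^sub>E I W. \<Sum>x\<in>Pi\<^sub>E I W. \<Prod>i\<in>I. g i (w i) (x i))"
  using assms by (simp add: prod_sum_PiE)

text \<open>Extensionality turns \<open>u \<noteq> v\<close> into a coordinate in \<open>I\<close>
  where the tuples differ, hence into a zero factor.\<close>

lemma kronecker_identity:
  assumes "finite I" "u \<in> Pi\<^sub>E I V" "v \<in> Pi\<^sub>E I V"
  shows "kronecker I (\<lambda>_. identity) u v = identity u v"
proof (cases "u = v")
  case False
  then obtain i where "i \<in> I" "u i \<noteq> v i" using assms PiE_ext by metis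
  then show ?thesis using assms(1) False by (auto simp: kronecker_def identity_def intro!: prod_zero)
qed (simp add: kronecker_def identity_def)

text \<open>This is the linear-algebraic half, for arbitrary real matrices \<open>M i\<close> whose
  eigenvalues are listed by \<open>e i\<close>; the graph structure enters only when
  \<open>L\<close> is instantiated.\<close>

lemma eigenvalues_kronecker_sum:
  fixes M :: "'i \<Rightarrow> 'a \<Rightarrow> 'a \<Rightarrow> real" and e :: "'i \<Rightarrow> nat \<Rightarrow> real"
  assumes I: "finite I" and V: "\<And>i. i \<in> I \<Longrightarrow> finite (V i)" "\<And>i. i \<in> I \<Longrightarrow> card (V i) = n i"
    and ev: "\<And>i. i \<in> I \<Longrightarrow> eigenvalues (V i) (M i) = {#e i j. j \<in># mset_set {1..n i}#}"
    and L: "\<And>u v. u \<in> Pi\<^sub>E I V \<Longrightarrow> v \<in> Pi\<^sub>E I V \<Longrightarrow>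
      L u v = (\<Sum>i\<in>I. kronecker I (\<lambda>k. if k = i then M k else identity) u v)"
  shows "eigenvalues (Pi\<^sub>E I V) L = {#\<Sum>i\<in>I. e i (j i). j \<in># mset_set (\<Pi>\<^sub>E i\<in>I. {1..n i})#}"
proof -
  define W where "W = (\<lambda>i. {1..n i})"
  have "\<forall>i\<in>I. \<exists>P Q T.
    (\<forall>u\<in>V i. \<forall>v\<in>V i. (\<Sum>a\<in>W i. P u a * Q a v) = identity u v) \<and>
    (\<forall>u\<in>V i. \<forall>v\<in>V i. M i u v = (\<Sum>a\<in>W i. \<Sum>b\<in>W i. P u a * T a b * Q b v)) \<and>
    (\<forall>a\<in>W i. \<forall>b\<in>W i. T a b \<noteq> 0 \<longrightarrow> a \<le> b) \<and> (\<forall>a\<in>W i. T a a = e i a)"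
    using triangularization_exists[OF V ev] unfolding W_def by (intro ballI)
  then obtain P Q T where
    PQ: "\<And>i u v. i \<in> I \<Longrightarrow> u \<in> V i \<Longrightarrow> v \<in> V i \<Longrightarrow> (\<Sum>a\<in>W i. P i u a * Q i a v) = identity u v"
    and PTQ: "\<And>i u v. i \<in> I \<Longrightarrow> u \<in> V i \<Longrightarrow> v \<in> V i \<Longrightarrow>
      M i u v = (\<Sum>a\<in>W i. \<Sum>b\<in>W i. P i u a * T i a b * Q i b v)"
    and T: "\<And>i a b. i \<in> I \<Longrightarrow> a \<in> W i \<Longrightarrow> b \<in> W i \<Longrightarrow> T i a b \<noteq> 0 \<Longrightarrow> a \<le> b"
    and Te: "\<And>i a. i \<in> I \<Longrightarrow> a \<in> W i \<Longrightarrow> T i a a = e i a"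
    unfolding bchoice_iff by blast
  have W: "finite (W i)" for i by (simp add: W_def)
  define TT where "TT = (\<lambda>w x. \<Sum>i\<in>I. kronecker I (\<lambda>k. if k = i then T k else identity) w x)"
  \<comment> \<open>The identity is written in the same form as \<open>PTQ\<close>, so that every
    factor of a summand is transformed by the \<open>P\<close> and \<open>Q\<close> of its own
    index.\<close>
  have PIQ: "identity u v = (\<Sum>a\<in>W i. \<Sum>b\<in>W i. P i u a * identity a b * Q i b v)"
    if "i \<in> I" "u \<in> V i" "v \<in> V i" for i u v
  proof -
    have "(\<Sum>b\<in>W i. P i u a * identity a b * Q i b v) = P i u a * Q i a v" if "a \<in> W i" for a
    proof -
      have "(\<Sum>b\<in>W i. P i u a * identity a b * Q i b v) =
          (\<Sum>b\<in>W i. if a = b then P i u a * Q i b v else 0)"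
        by (rule sum.cong) (auto simp: identity_def)
      then show ?thesis using that W by simp
    qed
    then show ?thesis using PQ[OF that] by simp
  qed
  have "eigenvalues (Pi\<^sub>E I V) L = {#TT w w. w \<in># mset_set (Pi\<^sub>E I W)#}"
  \<comment> \<open>The global transition matrices are the Kronecker products of those of the
    factors, and the weight of a tuple is its coordinate sum.\<close>
  proof (rule eigenvalues_triangular[where T = TT and P = "\<lambda>u w. \<Prod>i\<in>I. P i (u i) (w i)"
        and Q = "\<lambda>w u. \<Prod>i\<in>I. Q i (w i) (u i)" and f = "\<lambda>w. \<Sum>i\<in>I. w i"])
    show "finite (Pi\<^sub>E I V)" "finite (Pi\<^sub>E I W)" using I V W by (auto intro: finite_PiE)
    show "card (Pi\<^sub>E I V) = card (Pi\<^sub>E I W)"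
      using I V by (simp add: card_PiE W_def)
  next
    fix u v assume uv: "u \<in> Pi\<^sub>E I V" "v \<in> Pi\<^sub>E I V"
    then have uvi: "u i \<in> V i" "v i \<in> V i" if "i \<in> I" for i using that by (auto simp: PiE_iff)
    have "(\<Sum>w\<in>Pi\<^sub>E I W. (\<Prod>i\<in>I. P i (u i) (w i)) * (\<Prod>i\<in>I. Q i (w i) (v i))) =
        (\<Prod>i\<in>I. \<Sum>a\<in>W i. P i (u i) a * Q i a (v i))"
      using I W by (simp add: prod_sum_PiE prod.distrib)
    also have "\<dots> = kronecker I (\<lambda>_. identity) u v"
      unfolding kronecker_def by (intro prod.cong refl PQ uvi)
    finally show "(\<Sum>w\<in>Pi\<^sub>E I W. (\<Prod>i\<in>I. P i (u i) (w i)) * (\<Prod>i\<in>I. Q i (w i) (v i))) = identity u v"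
      using kronecker_identity[OF I uv] by simp
    have "kronecker I (\<lambda>k. if k = i then M k else identity) u v =
        (\<Sum>w\<in>Pi\<^sub>E I W. \<Sum>x\<in>Pi\<^sub>E I W. (\<Prod>k\<in>I. P k (u k) (w k)) *
          kronecker I (\<lambda>k. if k = i then T k else identity) w x * (\<Prod>k\<in>I. Q k (x k) (v k)))" for i
    proof -
      have "kronecker I (\<lambda>k. if k = i then M k else identity) u v =
          (\<Prod>k\<in>I. \<Sum>a\<in>W k. \<Sum>b\<in>W k. P k (u k) a * (if k = i then T k else identity) a b * Q k b (v k))"
        unfolding kronecker_def
      proof (intro prod.cong refl)
        fix k assume k: "k \<in> I"
        show "(if k = i then M k else identity) (u k) (v k) =
          (\<Sum>a\<in>W k. \<Sum>b\<in>W k. P k (u k) a * (if k = i then T k else identity) a b * Q k b (v k))"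
          using PTQ[OF k uvi[OF k]] PIQ[OF k uvi[OF k]] by (cases "k = i") simp_all
      qed
      then show ?thesis
        by (simp add: prod_sum_sum_PiE I W prod.distrib kronecker_def)
    qed
    then have "L u v = (\<Sum>i\<in>I. \<Sum>w\<in>Pi\<^sub>E I W. \<Sum>x\<in>Pi\<^sub>E I W. (\<Prod>k\<in>I. P k (u k) (w k)) *
          kronecker I (\<lambda>k. if k = i then T k else identity) w x * (\<Prod>k\<in>I. Q k (x k) (v k)))"
      using L[OF uv] by simp
    also have "\<dots> = (\<Sum>w\<in>Pi\<^sub>E I W. \<Sum>x\<in>Pi\<^sub>E I W. \<Sum>i\<in>I. (\<Prod>k\<in>I. P k (u k) (w k)) *
          kronecker I (\<lambda>k. if k = i then T k else identity) w x * (\<Prod>k\<in>I. Q k (x k) (v k)))"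
      by (subst sum.swap) (intro sum.cong refl sum.swap)
    finally show "L u v = (\<Sum>w\<in>Pi\<^sub>E I W. \<Sum>x\<in>Pi\<^sub>E I W.
        (\<Prod>i\<in>I. P i (u i) (w i)) * TT w x * (\<Prod>i\<in>I. Q i (x i) (v i)))"
      by (simp add: TT_def sum_distrib_left sum_distrib_right)
  next
    fix w x assume wx: "w \<in> Pi\<^sub>E I W" "x \<in> Pi\<^sub>E I W" "TT w x \<noteq> 0"
    then obtain i where i: "i \<in> I" "kronecker I (\<lambda>k. if k = i then T k else identity) w x \<noteq> 0"
      unfolding TT_def by (meson sum.neutral)
    then have "\<forall>k\<in>I - {i}. w k = x k" "T i (w i) (x i) \<noteq> 0"
      unfolding kronecker_one_factor[OF I i(1)] by (auto split: if_splits)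
    \<comment> \<open>Equality holds away from \<open>i\<close>; at \<open>i\<close> the inequality
      is triangularity of \<open>T i\<close>.\<close>
    then have le: "w k \<le> x k" if "k \<in> I" for k
      using T[OF i(1), of "w i" "x i"] wx i(1) that by (cases "k = i") (auto simp: PiE_iff)
    show "w = x \<or> (\<Sum>i\<in>I. w i) < (\<Sum>i\<in>I. x i)"
    proof (cases "w = x")
      case False
      then obtain k where "k \<in> I" "w k \<noteq> x k" using wx PiE_ext by metis
      then have "w k < x k" using le[of k] by simp
      then show ?thesis using \<open>k \<in> I\<close> I le by (intro disjI2 sum_strict_mono_ex1) auto
    qed simp
  qed
  also have "\<dots> = {#\<Sum>i\<in>I. e i (w i). w \<in># mset_set (Pi\<^sub>E I W)#}"
  proof (rule image_mset_cong)
    fix w assume "w \<in># mset_set (Pi\<^sub>E I W)"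
    then have w: "w i \<in> W i" if "i \<in> I" for i
      using that I W by (auto simp: finite_PiE PiE_iff)
    \<comment> \<open>On the diagonal the agreement condition always holds, so each summand is the
      diagonal entry of \<open>T i\<close> at \<open>w i\<close>.\<close>
    show "TT w w = (\<Sum>i\<in>I. e i (w i))"
      unfolding TT_def by (intro sum.cong refl) (simp add: kronecker_one_factor[OF I] Te w)
  qed
  finally show ?thesis by (simp add: W_def)
qed

text \<open>The entrywise formula for the Laplacian is proved first and then serves as the
  hypothesis on \<open>L\<close> in the Kronecker sum lemma, which gives the spectrum.\<close>

theorem theorem3p7:
  fixes \<nu> :: nat and S :: "nat \<Rightarrow> 'a sgraph" and n :: "nat \<Rightarrow> nat"
    and ev :: "nat \<Rightarrow> nat \<Rightarrow> real"
  assumes "\<And>i. i \<in> {1..\<nu>} \<Longrightarrow> signed_graph (S i)"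
    and "\<And>i. i \<in> {1..\<nu>} \<Longrightarrow> card (verts (S i)) = n i"
    and "\<And>i. i \<in> {1..\<nu>} \<Longrightarrow>
           laplacian_eigenvalues (S i) = {#ev i j. j \<in># mset_set {1..n i}#}"
  shows "(\<forall>u \<in> verts (cartesian_product {1..\<nu>} S). \<forall>v \<in> verts (cartesian_product {1..\<nu>} S).
            laplacian (cartesian_product {1..\<nu>} S) u v =
              (\<Sum>i\<in>{1..\<nu>}. kronecker {1..\<nu>} (\<lambda>k. if k = i then laplacian (S k) else identity) u v))
       \<and> laplacian_eigenvalues (cartesian_product {1..\<nu>} S) =
           {#\<Sum>i\<in>{1..\<nu>}. ev i (j i). j \<in># mset_set (\<Pi>\<^sub>E i\<in>{1..\<nu>}. {1..n i})#}"
proof -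
  let ?C = "cartesian_product {1..\<nu>} S"
  let ?K = "\<lambda>i. kronecker {1..\<nu>} (\<lambda>k. if k = i then laplacian (S k) else identity)"
  have lap: "laplacian ?C u v = (\<Sum>i\<in>{1..\<nu>}. ?K i u v)" if "u \<in> verts ?C" "v \<in> verts ?C" for u v
    using assms(1) that by (intro laplacian_cartesian_product) simp_all
  have "laplacian_eigenvalues ?C =
      {#\<Sum>i\<in>{1..\<nu>}. ev i (j i). j \<in># mset_set (\<Pi>\<^sub>E i\<in>{1..\<nu>}. {1..n i})#}"
    unfolding laplacian_eigenvalues_def verts_cartesian_product
  proof (rule eigenvalues_kronecker_sum[where M = "\<lambda>i. laplacian (S i)"])
    show "finite (verts (S i))" if "i \<in> {1..\<nu>}" for i
      using assms(1)[OF that] by (rule signed_graph.finite_verts)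
    show "card (verts (S i)) = n i" if "i \<in> {1..\<nu>}" for i
      using assms(2)[OF that] .
    show "eigenvalues (verts (S i)) (laplacian (S i)) = {#ev i j. j \<in># mset_set {1..n i}#}"
      if "i \<in> {1..\<nu>}" for i
      using assms(3)[OF that] unfolding laplacian_eigenvalues_def .
    show "laplacian ?C u v = (\<Sum>i\<in>{1..\<nu>}. ?K i u v)"
      if "u \<in> (\<Pi>\<^sub>E i\<in>{1..\<nu>}. verts (S i))" "v \<in> (\<Pi>\<^sub>E i\<in>{1..\<nu>}. verts (S i))" for u v
      using lap that unfolding verts_cartesian_product .
  qed simp
  with lap show ?thesis by simp
qed

end
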